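(* Let $G$ be an additive abelian group, let $A \in G_\ast^{m\times n}$ be a partial matrix, let $B \in G^{(m-1)\times(n-1)}$, and let $\widetilde B \in G^{m\times n}$ be any matrix with $\sigma_-(\widetilde B) = B$. Then $A$ is consistent with $B$ if and only if the partial matrix $A - \widetilde B$ is cycle-balanced. In this case, $A$ has a unique completion $C$ satisfying $\sigma_-(C) = B$ if and only if the graph $H_A$ is connected. Moreover, if $|G| = k$ is finite and $A$ is consistent with $B$, then there are exactly $k^{c(H_A)-1}$ completions of $A$ that are preimages of $B$ under $\sigma_-$, where $c(H_A)$ is the number of connected components of $H_A$.
   Context: $G^{m\times n}$ is the group of $m\times n$ matrices over $G$. The balanced collapsing sum of $A\in G^{m\times n}$ is the $(m-1)\times(n-1)$ matrix $\sigma_-(A)$ with entries $\sigma_-(A)_{i,j} = a_{i,j} - a_{i+1,j} - a_{i,j+1} + a_{i+1,j+1}$. Let $\ast$ be a symbol not in $G$ (a blank entry). A partial matrix is a matrix with entries in $G\cup\{\ast\}$; $G_\ast^{m\times n}$ is the set of $m\times n$ partial matrices. For partial matrices $A,B$ of the same size, $(A-B)_{i,j} = a_{i,j}-b_{i,j}$ if both $a_{i,j}\neq\ast$ and $b_{i,j}\neq\ast$, and $(A-B)_{i,j}=\ast$ otherwise. A completion of $A\in G_\ast^{m\times n}$ is a matrix $C\in G^{m\times n}$ with $c_{i,j}=a_{i,j}$ whenever $a_{i,j}\neq\ast$. $A$ is consistent with $B\in G^{(m-1)\times(n-1)}$ if $A$ has a completion $C$ with $\sigma_-(C)=B$. $H_A$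 is the bipartite graph with vertex classes $\{x_i : i\in[m]\}$ and $\{y_j : j\in[n]\}$ and an edge $(x_i,y_j)$ exactly when $a_{i,j}\neq\ast$. A sequence $c=(i_1,j_1,i_2,j_2,\dots,j_k,i_1)$ is a cycle in $A$ if $(x_{i_1},y_{j_1},x_{i_2},\dots,y_{j_k},x_{i_1})$ is a cycle in $H_A$, i.e. a closed walk in $H_A$ not repeating edges. Such a cycle (with $i_{k+1}=i_1$) is balanced if $\sum_{r=1}^k (a_{i_r,j_r} - a_{i_{r+1},j_r}) = 0$, and $A$ is cycle-balanced if every cycle in $A$ is balanced (vacuously so if there are no cycles).
   Formalization: The claim that a unique completion forces H_A to be connected is stated only for G with a nonzero element, since it fails for trivial G (e.g. a 1×2 all-blank A); that connectedness implies uniqueness is stated for every G. *)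

theory Defs
  imports "Jordan_Normal_Form.Matrix" "Graph_Theory.Graph_Theory"
begin

text \<open>
  Rows and columns are indexed from 0, as in \<^theory>\<open>Jordan_Normal_Form.Matrix\<close>.
  The group is the whole type \<open>'a :: ab_group_add\<close>, which may be trivial.
  A partial matrix is an \<open>'a option mat\<close>; the blank entry is \<^const>\<open>None\<close>.
\<close>

definition collapsing_sum :: "'a::ab_group_add mat \<Rightarrow> 'a mat" where
  "collapsing_sum A = mat (dim_row A - 1) (dim_col A - 1)
     (\<lambda>(i, j). A $$ (i, j) - A $$ (i + 1, j) - A $$ (i, j + 1) + A $$ (i + 1, j + 1))"

definition partial_of :: "'a mat \<Rightarrow> 'a option mat" where
  "partial_of A = map_mat Some A"

definition partial_diff :: "'a::ab_group_add option mat \<Rightarrow> 'a option mat \<Rightarrow> 'a option mat" where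
  "partial_diff A B = mat (dim_row A) (dim_col A)
     (\<lambda>ij. case (A $$ ij, B $$ ij) of (Some a, Some b) \<Rightarrow> Some (a - b) | _ \<Rightarrow> None)"

definition completion :: "'a option mat \<Rightarrow> 'a mat \<Rightarrow> bool" where
  "completion A C \<longleftrightarrow> C \<in> carrier_mat (dim_row A) (dim_col A) \<and>
     (\<forall>i < dim_row A. \<forall>j < dim_col A. \<forall>a. A $$ (i, j) = Some a \<longrightarrow> C $$ (i, j) = a)"

definition consistent :: "'a::ab_group_add option mat \<Rightarrow> 'a mat \<Rightarrow> bool" where
  "consistent A B \<longleftrightarrow> (\<exists>C. completion A C \<and> collapsing_sum C = B)"

text \<open>
  The bipartite graph \<open>H\<^sub>A\<close>: \<open>Inl i\<close> is the row vertex \<open>x\<^sub>i\<close> and \<open>Inr j\<close> the column vertex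
  \<open>y\<^sub>j\<close>. As usual for this graph library, an undirected edge is a pair of opposite arcs, so
  connected components are strongly connected components.
\<close>

definition entry_graph ::
    "'a option mat \<Rightarrow> (nat + nat, (nat + nat) \<times> (nat + nat)) pre_digraph" where
  "entry_graph A = with_proj
     \<lparr> pverts = Inl ` {..<dim_row A} \<union> Inr ` {..<dim_col A},
       parcs = (\<Union>(i, j) \<in> {(i, j). i < dim_row A \<and> j < dim_col A \<and> A $$ (i, j) \<noteq> None}.
                  {(Inl i, Inr j), (Inr j, Inl i)}) \<rparr>"

lemma graph_entry_graph: "graph (entry_graph A)"
proof -
  let ?H = "entry_graph A"
  have eq: "verts ?H = Inl ` {..<dim_row A} \<union> Inr ` {..<dim_col A}"
    "arcs ?H = (\<Union>(i, j) \<in> {(i, j). i < dim_row A \<and> j < dim_col A \<and> A $$ (i, j) \<noteq> None}.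
                  {(Inl i, Inr j), (Inr j, Inl i)})"
    "tail ?H = fst" "head ?H = snd"
    by (simp_all add: entry_graph_def)
  have wf: "wf_digraph ?H" by unfold_locales (auto simp: eq)
  have "finite {(i, j). i < dim_row A \<and> j < dim_col A \<and> A $$ (i, j) \<noteq> None}"
    by (rule finite_subset[of _ "{..<dim_row A} \<times> {..<dim_col A}"]) auto
  then have "finite (arcs ?H)" by (auto simp: eq)
  then show ?thesis
    by unfold_locales (auto simp: eq arc_to_ends_def symmetric_def arcs_ends_def intro!: symI)
qed

definition num_components :: "('v, 'e) pre_digraph \<Rightarrow> nat" where
  "num_components H = card (pre_digraph.sccs H)"

text \<open>
  A cycle is a closed walk that repeats no edge (vertices may repeat). Edges are compared as
  unordered pairs, because the two arcs of one edge are distinct.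
\<close>

definition graph_cycle :: "('v, 'e) pre_digraph \<Rightarrow> 'v list \<Rightarrow> bool" where
  "graph_cycle H p \<longleftrightarrow> vwalk p H \<and> hd p = last p \<and> vwalk_arcs p \<noteq> [] \<and>
     distinct (map (\<lambda>(u, v). {u, v}) (vwalk_arcs p))"

text \<open>The sequence \<open>(i\<^sub>1, j\<^sub>1, \<dots>, i\<^sub>k, j\<^sub>k, i\<^sub>1)\<close> is encoded as the list of the pairs \<open>(i\<^sub>r, j\<^sub>r)\<close>.\<close>

definition cycle_in :: "'a option mat \<Rightarrow> (nat \<times> nat) list \<Rightarrow> bool" where
  "cycle_in A c \<longleftrightarrow> c \<noteq> [] \<and>
     graph_cycle (entry_graph A) (concat (map (\<lambda>(i, j). [Inl i, Inr j]) c) @ [Inl (fst (hd c))])"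

definition balanced_cycle :: "'a::ab_group_add option mat \<Rightarrow> (nat \<times> nat) list \<Rightarrow> bool" where
  "balanced_cycle A c \<longleftrightarrow>
     (\<Sum>r < length c. the (A $$ (fst (c ! r), snd (c ! r))) -
        the (A $$ (fst (c ! ((r + 1) mod length c)), snd (c ! r)))) = 0"

definition cycle_balanced :: "'a::ab_group_add option mat \<Rightarrow> bool" where
  "cycle_balanced A \<longleftrightarrow> (\<forall>c. cycle_in A c \<longrightarrow> balanced_cycle A c)"

end

theory Submission
  imports Defs
begin

text \<open>
  The kernel of \<open>\<sigma>\<^sub>-\<close> consists of the matrices with entries \<open>f x\<^sub>i - f y\<^sub>j\<close> for a function \<open>f\<close> on the
  vertices of \<open>H\<^sub>A\<close>. So \<open>A\<close> is consistent with \<open>B\<close> iff the entries of \<open>A - B'\<close> are the differences of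
  a potential \<open>f\<close> along the edges. Sums of such differences around a cycle telescope to zero;
  conversely, if all cycles are balanced, a potential is built by inserting the edges one by one:
  either the new edge closes a cycle and the potential already fits, or it joins two components and
  the potential can be shifted by a constant on one of them. Two completions of \<open>A\<close> with collapsing
  sum \<open>B\<close> differ by a potential that is constant on the components, normalised to vanish on the
  component of \<open>x\<^sub>0\<close>.
\<close>

section \<open>The kernel of the collapsing sum\<close>

text \<open>Equal collapsing sums make the change of \<open>C - C'\<close> from one row to the next
  the same in every column, so each entry splits into a row part and a column part.\<close>

lemma collapsing_sum_eq_iff:
  fixes C C' :: "'a::ab_group_add mat"
  assumes C: "C \<in> carrier_mat m n" "C' \<in> carrier_mat m n"
  shows "collapsing_sum C = collapsing_sum C' \<longleftrightarrow>
    (\<exists>f. \<forall>i<m. \<forall>j<n. C $$ (i, j) - C' $$ (i, j) = f (Inl i :: nat + nat) - f (Inr j))"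
    (is "?L \<longleftrightarrow> ?R")
proof
  assume ?L
  define E where "E = (\<lambda>i j. C $$ (i, j) - C' $$ (i, j))"
  have step: "E (Suc i) (Suc j) - E i (Suc j) = E (Suc i) j - E i j"
    if "Suc i < m" "Suc j < n" for i j
  proof -
    have "collapsing_sum C $$ (i, j) = collapsing_sum C' $$ (i, j)"
      using \<open>?L\<close> by simp
    then show ?thesis
      using C that by (simp add: collapsing_sum_def E_def algebra_simps)
  qed
  have row: "E (Suc i) j - E i j = E (Suc i) 0 - E i 0" if "Suc i < m" "j < n" for i j
    using that(2) by (induction j) (use step that(1) in auto)
  have E: "E i j = E i 0 + E 0 j - E 0 0" if "i < m" "j < n" for i j
    using that(1)
  proof (induction i)
    case (Suc i)
    have "E (Suc i) j = E (Suc i) 0 - E i 0 + E i j"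
      unfolding row[OF Suc.prems that(2), symmetric] by simp
    also have "E i j = E i 0 + E 0 j - E 0 0"
      by (rule Suc.IH) (use Suc.prems in simp)
    finally show ?case
      by (simp add: algebra_simps)
  qed simp
  have "E i j = E i 0 - (E 0 0 - E 0 j)" if "i < m" "j < n" for i j
    unfolding diff_diff_eq2 using that by (rule E)
  then have "C $$ (i, j) - C' $$ (i, j) = E i 0 - (E 0 0 - E 0 j)" if "i < m" "j < n" for i j
    using that unfolding E_def by blast
  \<comment> \<open>The column part changes sign, since \<open>f\<close> at the column vertex is
    subtracted.\<close>
  then show ?R
    by (intro exI[of _ "case_sum (\<lambda>i. E i 0) (\<lambda>j. E 0 0 - E 0 j)"]) simp
next
  assume ?R
  then obtain f where f: "C $$ (i, j) = C' $$ (i, j) + (f (Inl i :: nat + nat) - f (Inr j))"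
    if "i < m" "j < n" for i j
    by (metis add.commute diff_add_cancel)
  show ?L
  proof (rule eq_matI)
    fix i j
    assume "i < dim_row (collapsing_sum C')" "j < dim_col (collapsing_sum C')"
    then have ij: "Suc i < m" "Suc j < n"
      using C by (auto simp: collapsing_sum_def)
    then have "i < m" "j < n"
      by auto
    with ij show "collapsing_sum C $$ (i, j) = collapsing_sum C' $$ (i, j)"
      using C by (simp add: collapsing_sum_def f algebra_simps)
  qed (use C in \<open>auto simp: collapsing_sum_def\<close>)
qed

section \<open>Paths and cycles\<close>

lemma ends_in_set_vwalk_arcs: "(x, y) \<in> set (vwalk_arcs p) \<Longrightarrow> x \<in> set p \<and> y \<in> set p"
  by (induction p rule: vwalk_arcs.induct) auto

lemma set_subset_vwalk_arcs: "p \<noteq> [] \<Longrightarrow> set p \<subseteq> insert (last p) (fst ` set (vwalk_arcs p))"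
  by (induction p rule: vwalk_arcs.induct) auto

text \<open>The first vertex lies on the first edge and on no later one, so that edge cannot recur
  in either direction.\<close>

lemma distinct_vwalk_edges:
  "distinct p \<Longrightarrow> distinct (map (\<lambda>(u, v). {u, v}) (vwalk_arcs p))"
proof (induction p rule: vwalk_arcs.induct)
  case (3 x y xs)
  have "x \<in> set (y # xs)"
    if "(a, b) \<in> set (vwalk_arcs (y # xs))" "{x, y} = {a, b}" for a b
    using ends_in_set_vwalk_arcs[OF that(1)] that(2) by (metis doubleton_eq_iff)
  then show ?case
    using 3 by fastforce
qed auto

lemma vwalk_arcs_snoc: "p \<noteq> [] \<Longrightarrow> vwalk_arcs (p @ [z]) = vwalk_arcs p @ [(last p, z)]"
  by (induction p rule: vwalk_arcs.induct) auto

lemma set_vwalk_arcs_suffix: "set (vwalk_arcs ys) \<subseteq> set (vwalk_arcs (xs @ ys))"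
proof (induction xs)
  case (Cons x xs)
  then show ?case
    by (cases "xs @ ys") auto
qed simp

text \<open>Distinct vertices are wanted because they give distinct edges. If a prepended vertex
  already occurs, the path is cut back to that occurrence.\<close>

lemma rtrancl_distinct_path:
  assumes "(u, v) \<in> R\<^sup>*"
  obtains p where "p \<noteq> []" "hd p = u" "last p = v" "distinct p" "set (vwalk_arcs p) \<subseteq> R"
proof -
  have "\<exists>p. p \<noteq> [] \<and> hd p = u \<and> last p = v \<and> distinct p \<and> set (vwalk_arcs p) \<subseteq> R"
    using assms
  proof (induction rule: converse_rtrancl_induct)
    case base
    show ?case
      by (intro exI[of _ "[v]"]) auto
  next
    case (step x y)
    then obtain p where p: "p \<noteq> []" "hd p = y" "last p = v" "distinct p" "set (vwalk_arcs p) \<subseteq> R"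
      by blast
    show ?case
    proof (cases "x \<in> set p")
      case True
      then obtain xs ys where "p = xs @ x # ys"
        by (meson split_list)
      with p show ?thesis
        using set_vwalk_arcs_suffix[of "x # ys" xs] by (intro exI[of _ "x # ys"]) auto
    next
      case False
      with p step(1) show ?thesis
        by (intro exI[of _ "x # p"]) (cases p; auto)
    qed
  qed
  then show thesis
    using that by blast
qed

text \<open>The graph is attached to a set of positions instead of a matrix, so that edges can be
  inserted one by one.\<close>

definition arcs_of :: "(nat \<times> nat) set \<Rightarrow> ((nat + nat) \<times> (nat + nat)) set" where
  "arcs_of S = (\<lambda>(i, j). (Inl i, Inr j)) ` S \<union> (\<lambda>(i, j). (Inr j, Inl i)) ` S"

lemma in_arcs_of_iff [simp]:
  "(Inl i, Inr j) \<in> arcs_of S \<longleftrightarrow> (i, j) \<in> S"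
  "(Inr j, Inl i) \<in> arcs_of S \<longleftrightarrow> (i, j) \<in> S"
  "(Inl i, Inl i') \<notin> arcs_of S"
  "(Inr j, Inr j') \<notin> arcs_of S"
  by (auto simp: arcs_of_def)

abbreviation alternating :: "(nat \<times> nat) list \<Rightarrow> (nat + nat) list" where
  "alternating c \<equiv> concat (map (\<lambda>(i, j). [Inl i, Inr j]) c)"

text \<open>Every arc changes sides, so a walk from a row to a column splits into consecutive pairs,
  the encoding used for cycles.\<close>

lemma alternating_path:
  assumes "p \<noteq> []" "hd p = Inl i" "last p = Inr j" "set (vwalk_arcs p) \<subseteq> arcs_of S"
  obtains c where "c \<noteq> []" "p = alternating c" "fst (hd c) = i" "snd (last c) = j"
proof -
  have "\<exists>c. c \<noteq> [] \<and> p = alternating c \<and> fst (hd c) = i \<and> snd (last c) = j"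
    using assms
  proof (induction "length p" arbitrary: p i rule: less_induct)
    case less
    obtain y ys where p: "p = Inl i # y # ys"
      using less.prems by (cases p; cases "tl p") auto
    obtain k where y: "y = Inr k"
      using less.prems(4) p by (cases y) auto
    show ?case
    proof (cases ys)
      case Nil
      with less.prems p y show ?thesis
        by (intro exI[of _ "[(i, k)]"]) auto
    next
      case (Cons z zs)
      obtain i' where z: "z = Inl i'"
        using less.prems(4) p y Cons by (cases z) auto
      have "\<exists>c. c \<noteq> [] \<and> ys = alternating c \<and> fst (hd c) = i' \<and> snd (last c) = j"
        by (rule less.hyps) (use less.prems p y Cons z in auto)
      then obtain c where "c \<noteq> []" "ys = alternating c" "fst (hd c) = i'" "snd (last c) = j"
        by blast
      with p y show ?thesis
        by (intro exI[of _ "(i, k) # c"]) auto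
    qed
  qed
  then show thesis
    using that by blast
qed

text \<open>This and \<open>nth_back_arc_alternating\<close> match the two kinds of terms in a cycle
  sum.\<close>

lemma nth_arc_alternating:
  assumes "r < length c"
  shows "(Inl (fst (c ! r)), Inr (snd (c ! r))) \<in> set (vwalk_arcs (alternating c))"
  using assms
proof (induction c arbitrary: r)
  case (Cons x c)
  obtain i j where x: "x = (i, j)"
    by fastforce
  have "set (vwalk_arcs (alternating c)) \<subseteq> set (vwalk_arcs (alternating (x # c)))"
    using set_vwalk_arcs_suffix[of "alternating c" "[Inl i, Inr j]"] x by simp
  with Cons x show ?case
    by (cases r) auto
qed simp

lemma nth_back_arc_alternating:
  assumes "Suc r < length c"
  shows "(Inr (snd (c ! r)), Inl (fst (c ! Suc r))) \<in> set (vwalk_arcs (alternating c))"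
  using assms
proof (induction c arbitrary: r)
  case (Cons x c)
  obtain i j where x: "x = (i, j)"
    by fastforce
  have sub: "set (vwalk_arcs (alternating c)) \<subseteq> set (vwalk_arcs (alternating (x # c)))"
    using set_vwalk_arcs_suffix[of "alternating c" "[Inl i, Inr j]"] x by simp
  show ?case
  proof (cases r)
    case 0
    then obtain i' j' c' where "c = (i', j') # c'"
      using Cons.prems by (cases c) auto
    with 0 x show ?thesis
      by simp
  next
    case (Suc r')
    with Cons sub show ?thesis
      by auto
  qed
qed simp

lemma vwalk_arcs_alternating_snoc:
  assumes "c \<noteq> []"
  shows "vwalk_arcs (alternating c @ [z]) = vwalk_arcs (alternating c) @ [(Inr (snd (last c)), z)]"
proof -
  have "alternating c \<noteq> [] \<and> last (alternating c) = Inr (snd (last c))"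
    using assms by (induction c rule: rev_induct) auto
  then show ?thesis
    using vwalk_arcs_snoc by metis
qed

section \<open>Potentials\<close>

text \<open>The sum that balance requires to vanish, for a total weight \<open>d\<close>, which
  keeps the potential argument free of options.\<close>

definition cycle_sum :: "(nat \<Rightarrow> nat \<Rightarrow> 'a::ab_group_add) \<Rightarrow> (nat \<times> nat) list \<Rightarrow> 'a" where
  "cycle_sum d c = (\<Sum>r < length c. d (fst (c ! r)) (snd (c ! r)) -
     d (fst (c ! ((r + 1) mod length c))) (snd (c ! r)))"

text \<open>
  The closing edge is left out of the hypotheses, so that the lemma both balances a cycle along
  which \<open>f\<close> is a potential and determines the weight of an edge that closes a cycle.
\<close>
lemma cycle_sum_potential:
  assumes "c \<noteq> []"
    and forward: "\<And>r. r < length c \<Longrightarrow>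
      d (fst (c ! r)) (snd (c ! r)) = f (Inl (fst (c ! r)) :: nat + nat) - f (Inr (snd (c ! r)))"
    and backward: "\<And>r. Suc r < length c \<Longrightarrow>
      d (fst (c ! Suc r)) (snd (c ! r)) = f (Inl (fst (c ! Suc r))) - f (Inr (snd (c ! r)))"
  shows "cycle_sum d c =
    f (Inl (fst (hd c))) - f (Inr (snd (last c))) - d (fst (hd c)) (snd (last c))"
proof -
  obtain k where k: "length c = Suc k"
    using assms(1) by (cases c) auto
  \<comment> \<open>For \<open>r < k\<close> the index does not wrap around and the two values of
    \<open>f\<close> at the column cancel. Only the last summand involves the closing edge.\<close>
  have "(\<Sum>r<k. d (fst (c ! r)) (snd (c ! r)) - d (fst (c ! ((r + 1) mod Suc k))) (snd (c ! r)))
    = (\<Sum>r<k. f (Inl (fst (c ! r))) - f (Inl (fst (c ! Suc r))))"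
    using forward backward k by (intro sum.cong) auto
  also have "\<dots> = f (Inl (fst (c ! 0))) - f (Inl (fst (c ! k)))"
    by (rule sum_lessThan_telescope')
  finally show ?thesis
    using assms(1) forward[of k] k
    by (simp add: cycle_sum_def hd_conv_nth last_conv_nth)
qed

text \<open>The cycle condition is phrased through \<open>arcs_of S\<close>, so it passes to
  subsets, as the induction on edges requires.\<close>

lemma ex_potential:
  fixes d :: "nat \<Rightarrow> nat \<Rightarrow> 'a::ab_group_add"
  assumes "finite S"
    and "\<And>c. c \<noteq> [] \<Longrightarrow>
      set (vwalk_arcs (alternating c @ [Inl (fst (hd c))])) \<subseteq> arcs_of S \<Longrightarrow>
      distinct (map (\<lambda>(u, v). {u, v}) (vwalk_arcs (alternating c @ [Inl (fst (hd c))]))) \<Longrightarrow>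
      cycle_sum d c = 0"
  shows "\<exists>f. \<forall>(i, j)\<in>S. d i j = f (Inl i :: nat + nat) - f (Inr j)"
  using assms
proof (induction S rule: finite_induct)
  case (insert e S)
  obtain i j where e: "e = (i, j)"
    by fastforce
  have mono: "arcs_of S \<subseteq> arcs_of (insert e S)"
    by (auto simp: arcs_of_def)
  have "\<exists>f. \<forall>(i, j)\<in>S. d i j = f (Inl i :: nat + nat) - f (Inr j)"
    using insert.IH insert.prems mono by (meson order_trans)
  then obtain f :: "nat + nat \<Rightarrow> 'a" where f: "\<And>i j. (i, j) \<in> S \<Longrightarrow> d i j = f (Inl i) - f (Inr j)"
    by auto
  show ?case
  proof (cases "(Inl i, Inr j) \<in> (arcs_of S)\<^sup>*")
    case True
    then obtain p where p: "p \<noteq> []" "hd p = Inl i" "last p = Inr j" "distinct p"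
      "set (vwalk_arcs p) \<subseteq> arcs_of S"
      by (rule rtrancl_distinct_path)
    from p(1-3,5) obtain c where c: "c \<noteq> []" "p = alternating c" "fst (hd c) = i" "snd (last c) = j"
      by (rule alternating_path)
    \<comment> \<open>The path closed by the new edge is a cycle: the edge is not on the path,
      because \<open>e\<close> is not in \<open>S\<close>.\<close>
    have arcs: "vwalk_arcs (alternating c @ [Inl i]) = vwalk_arcs p @ [(Inr j, Inl i)]"
      using vwalk_arcs_snoc[OF p(1)] p(3) c(2) by simp
    have "{u, v} \<noteq> {Inr j, Inl i}" if "(u, v) \<in> set (vwalk_arcs p)" for u v
      using that p(5) insert.hyps(2) e by (auto simp: doubleton_eq_iff)
    then have dist: "distinct (map (\<lambda>(u, v). {u, v}) (vwalk_arcs (alternating c @ [Inl i])))"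
      using distinct_vwalk_edges[OF p(4)] by (auto simp: arcs)
    have "cycle_sum d c = 0"
      using insert.prems[OF c(1)] dist p(5) mono arcs c(3) e by auto
    \<comment> \<open>All edges but the closing one are old, so the vanishing sum forces the weight
      of the new edge.\<close>
    moreover have "cycle_sum d c = f (Inl i) - f (Inr j) - d i j"
    proof -
      have "d (fst (c ! r)) (snd (c ! r)) = f (Inl (fst (c ! r))) - f (Inr (snd (c ! r)))"
        if "r < length c" for r
        using nth_arc_alternating[OF that] p(5) c(2) f by auto
      moreover have "d (fst (c ! Suc r)) (snd (c ! r)) = f (Inl (fst (c ! Suc r))) - f (Inr (snd (c ! r)))"
        if "Suc r < length c" for r
        using nth_back_arc_alternating[OF that] p(5) c(2) f by auto
      ultimately show ?thesis
        using cycle_sum_potential[OF c(1), of d f] c(3,4) by simp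
    qed
    ultimately have "d i j = f (Inl i) - f (Inr j)"
      by simp
    with f e show ?thesis
      by (intro exI[of _ f]) auto
  next
    case False
    \<comment> \<open>\<open>K\<close> is the old component of \<open>Inl i\<close> and misses
      \<open>Inr j\<close>. Shifting \<open>f\<close> on \<open>K\<close> by the defect of the new
      edge repairs it and keeps all old differences.\<close>
    define K where "K = {v. (Inl i, v) \<in> (arcs_of S)\<^sup>*}"
    define g where "g = (\<lambda>v. if v \<in> K then f v + (d i j - (f (Inl i) - f (Inr j))) else f v)"
    have "Inl i' \<in> K \<longleftrightarrow> Inr j' \<in> K" if "(i', j') \<in> S" for i' j'
      unfolding K_def using that by (auto intro: rtrancl_into_rtrancl)
    then have "d i' j' = g (Inl i') - g (Inr j')" if "(i', j') \<in> S" for i' j'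
      using f that by (auto simp: g_def)
    moreover have "d i j = g (Inl i) - g (Inr j)"
      using False by (simp add: g_def K_def)
    ultimately show ?thesis
      using e by (intro exI[of _ g]) auto
  qed
qed auto

section \<open>Consistency and completions\<close>

definition support :: "'a option mat \<Rightarrow> (nat \<times> nat) set" where
  "support A = {(i, j). i < dim_row A \<and> j < dim_col A \<and> A $$ (i, j) \<noteq> None}"

lemma finite_support: "finite (support A)"
  by (rule finite_subset[of _ "{..<dim_row A} \<times> {..<dim_col A}"]) (auto simp: support_def)

lemma verts_entry_graph:
  "verts (entry_graph A) = Inl ` {..<dim_row A} \<union> Inr ` {..<dim_col A}"
  by (simp add: entry_graph_def)

lemma arcs_ends_entry_graph: "arcs_ends (entry_graph A) = arcs_of (support A)"
  by (auto simp: entry_graph_def arcs_of_def support_def)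

text \<open>In a closed walk with an arc every vertex is the tail of some arc, so conditions on the
  arcs already place the walk in the graph. This gives the shape of the hypothesis of
  \<open>ex_potential\<close>.\<close>

lemma cycle_in_iff:
  "cycle_in A c \<longleftrightarrow> c \<noteq> [] \<and>
    set (vwalk_arcs (alternating c @ [Inl (fst (hd c))])) \<subseteq> arcs_of (support A) \<and>
    distinct (map (\<lambda>(u, v). {u, v}) (vwalk_arcs (alternating c @ [Inl (fst (hd c))])))"
proof (cases "c = []")
  case False
  let ?p = "alternating c @ [Inl (fst (hd c))]"
  have hd: "hd ?p = last ?p" "vwalk_arcs ?p \<noteq> []"
    using False by (cases c; auto simp: vwalk_arcs_snoc)+
  have "set ?p \<subseteq> verts (entry_graph A)" if "set (vwalk_arcs ?p) \<subseteq> arcs_of (support A)"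
  proof -
    have fst: "fst ` set (vwalk_arcs ?p) \<subseteq> verts (entry_graph A)"
      using that by (fastforce simp: arcs_of_def support_def verts_entry_graph)
    have "hd ?p \<in> fst ` set (vwalk_arcs ?p)"
      using False by (cases c) auto
    then show ?thesis
      using set_subset_vwalk_arcs[of ?p] fst hd(1) by auto
  qed
  then show ?thesis
    using False hd by (auto simp: cycle_in_def graph_cycle_def vwalk_def arcs_ends_entry_graph)
qed (simp add: cycle_in_def)

lemma balanced_cycle_iff: "balanced_cycle A c \<longleftrightarrow> cycle_sum (\<lambda>i j. the (A $$ (i, j))) c = 0"
  by (simp add: balanced_cycle_def cycle_sum_def)

text \<open>Backwards, the closing edge of a cycle is a filled position too, so the value given by
  \<open>cycle_sum_potential\<close> is zero.\<close>

lemma cycle_balanced_iff_potential: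
  fixes A :: "'a::ab_group_add option mat"
  shows "cycle_balanced A \<longleftrightarrow>
    (\<exists>f. \<forall>(i, j)\<in>support A. the (A $$ (i, j)) = f (Inl i :: nat + nat) - f (Inr j))"
    (is "_ \<longleftrightarrow> ?R")
proof
  assume "cycle_balanced A"
  then show ?R
    by (intro ex_potential finite_support)
      (simp add: cycle_balanced_def cycle_in_iff balanced_cycle_iff)
next
  assume ?R
  then obtain f :: "nat + nat \<Rightarrow> 'a"
    where f: "\<And>i j. (i, j) \<in> support A \<Longrightarrow> the (A $$ (i, j)) = f (Inl i) - f (Inr j)"
    by auto
  show "cycle_balanced A"
    unfolding cycle_balanced_def balanced_cycle_iff
  proof (intro allI impI)
    fix c
    assume "cycle_in A c"
    then have c: "c \<noteq> []"
      and sub: "set (vwalk_arcs (alternating c @ [Inl (fst (hd c))])) \<subseteq> arcs_of (support A)"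
      by (auto simp: cycle_in_iff)
    have sub': "set (vwalk_arcs (alternating c)) \<subseteq> arcs_of (support A)"
      and closing: "(fst (hd c), snd (last c)) \<in> support A"
      using sub by (simp_all add: vwalk_arcs_alternating_snoc[OF c])
    have "(fst (c ! r), snd (c ! r)) \<in> support A" if "r < length c" for r
      using subsetD[OF sub' nth_arc_alternating[OF that]] by simp
    moreover have "(fst (c ! Suc r), snd (c ! r)) \<in> support A" if "Suc r < length c" for r
      using subsetD[OF sub' nth_back_arc_alternating[OF that]] by simp
    ultimately have "cycle_sum (\<lambda>i j. the (A $$ (i, j))) c =
        f (Inl (fst (hd c))) - f (Inr (snd (last c))) - the (A $$ (fst (hd c), snd (last c)))"
      by (intro cycle_sum_potential c f)
    then show "cycle_sum (\<lambda>i j. the (A $$ (i, j))) c = 0"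
      using f[OF closing] by simp
  qed
qed

lemma completion_iff:
  "completion A C \<longleftrightarrow> C \<in> carrier_mat (dim_row A) (dim_col A) \<and>
    (\<forall>(i, j)\<in>support A. C $$ (i, j) = the (A $$ (i, j)))"
  by (auto simp: completion_def support_def)

text \<open>For a completion \<open>C\<close> with the required sum, \<open>C - B'\<close> has a
  potential and agrees with \<open>A - B'\<close> on the filled positions.\<close>

lemma consistent_iff_cycle_balanced:
  fixes A :: "'a::ab_group_add option mat"
  assumes A: "A \<in> carrier_mat m n" and B': "B' \<in> carrier_mat m n"
  shows "consistent A (collapsing_sum B') \<longleftrightarrow> cycle_balanced (partial_diff A (partial_of B'))"
    (is "_ \<longleftrightarrow> cycle_balanced ?D")
proof -
  have supp: "support ?D = support A"
    using A B' by (auto simp: support_def partial_diff_def partial_of_def split: option.splits)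
  have D: "the (?D $$ (i, j)) = the (A $$ (i, j)) - B' $$ (i, j)" if "(i, j) \<in> support A" for i j
    using that A B' by (auto simp: support_def partial_diff_def partial_of_def)
  have supp_lt: "i < m \<and> j < n" if "(i, j) \<in> support A" for i j
    using that A by (auto simp: support_def)
  show ?thesis
    unfolding cycle_balanced_iff_potential supp
  proof
    assume "consistent A (collapsing_sum B')"
    then obtain C where C: "completion A C" "collapsing_sum C = collapsing_sum B'"
      by (auto simp: consistent_def)
    have "C \<in> carrier_mat m n"
      using C(1) A by (auto simp: completion_def)
    then obtain f :: "nat + nat \<Rightarrow> 'a"
      where f: "\<forall>i<m. \<forall>j<n. C $$ (i, j) - B' $$ (i, j) = f (Inl i) - f (Inr j)"
      using collapsing_sum_eq_iff[OF _ B'] C(2) by blast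
    have "the (?D $$ (i, j)) = f (Inl i) - f (Inr j)" if "(i, j) \<in> support A" for i j
    proof -
      have "C $$ (i, j) = the (A $$ (i, j))"
        using C(1) that by (auto simp: completion_iff)
      then show ?thesis
        using f D[OF that] supp_lt[OF that] by metis
    qed
    then show "\<exists>f. \<forall>(i, j)\<in>support A. the (?D $$ (i, j)) = f (Inl i :: nat + nat) - f (Inr j)"
      by blast
  next
    assume "\<exists>f. \<forall>(i, j)\<in>support A. the (?D $$ (i, j)) = f (Inl i :: nat + nat) - f (Inr j)"
    then obtain f :: "nat + nat \<Rightarrow> 'a"
      where f: "\<And>i j. (i, j) \<in> support A \<Longrightarrow> the (?D $$ (i, j)) = f (Inl i) - f (Inr j)"
      by auto
    \<comment> \<open>Adding the potential to \<open>B'\<close> reproduces \<open>A\<close> where it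
      is filled, supplies the blanks and keeps the collapsing sum.\<close>
    define C where "C = mat m n (\<lambda>(i, j). B' $$ (i, j) + (f (Inl i) - f (Inr j)))"
    have "C $$ (i, j) = the (A $$ (i, j))" if "(i, j) \<in> support A" for i j
    proof -
      have "C $$ (i, j) = B' $$ (i, j) + the (?D $$ (i, j))"
        using supp_lt[OF that] f[OF that] by (simp add: C_def)
      then show ?thesis
        using D[OF that] by simp
    qed
    then have "completion A C"
      using A by (auto simp: completion_iff C_def)
    moreover have "collapsing_sum C = collapsing_sum B'"
      by (subst collapsing_sum_eq_iff[of _ m n]) (use B' in \<open>auto simp: C_def\<close>)
    ultimately show "consistent A (collapsing_sum B')"
      by (auto simp: consistent_def)
  qed
qed

section \<open>Components and the number of completions\<close>

lemma connected_iff_sccs_verts: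
  assumes "graph H" "v \<in> verts H"
  shows "connected H \<longleftrightarrow> pre_digraph.sccs_verts H = {pre_digraph.scc_of H v}"
proof -
  interpret graph H
    by fact
  \<comment> \<open>Connectedness refers to the symmetric closure, which adds no reachability here;
    \<open>v\<close> shows that the vertex set is nonempty.\<close>
  have "connected H \<longleftrightarrow> (\<forall>u\<in>verts H. \<forall>w\<in>verts H. u \<rightarrow>\<^sup>*\<^bsub>H\<^esub> w)"
    using assms(2) reachable_mk_symmetric_eq[OF sym_arcs]
    by (auto simp: connected_def strongly_connected_def)
  also have "\<dots> \<longleftrightarrow> (\<forall>u\<in>verts H. scc_of u = scc_of v)" (is "?L \<longleftrightarrow> ?R")
  proof
    assume ?L
    then show ?R
      using assms(2) by (auto simp: scc_of_def dest: reachable_in_verts)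
  next
    assume ?R
    then show ?L
      by (metis (no_types, lifting) in_scc_of_self mem_Collect_eq scc_of_def)
  qed
  also have "\<dots> \<longleftrightarrow> sccs_verts = {scc_of v}"
    using assms(2) by (auto simp: sccs_verts_conv_scc_of)
  finally show ?thesis .
qed

text \<open>Every component except that of \<open>Inl 0\<close> receives a free group element. A
  common shift of a potential changes no difference, and the value 0 at \<open>Inl 0\<close> removes
  this freedom. The bijection serves both uniqueness and the count.\<close>

lemma bij_betw_completions:
  fixes A :: "'a::ab_group_add option mat"
  assumes A: "A \<in> carrier_mat m n" and "m \<ge> 1" "n \<ge> 1"
    and C0: "completion A C0"
  defines "H \<equiv> entry_graph A"
  defines "K \<equiv> pre_digraph.scc_of H"
  shows "\<exists>F. bij_betw F ((pre_digraph.sccs_verts H - {K (Inl 0)}) \<rightarrow>\<^sub>E (UNIV :: 'a set))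
    {C. completion A C \<and> collapsing_sum C = collapsing_sum C0}"
proof -
  interpret graph H
    unfolding H_def by (rule graph_entry_graph)
  define P where "P = (sccs_verts - {K (Inl 0)}) \<rightarrow>\<^sub>E (UNIV :: 'a set)"
  define \<psi> :: "((nat + nat) set \<Rightarrow> 'a) \<Rightarrow> nat + nat \<Rightarrow> 'a"
    where "\<psi> = (\<lambda>\<phi> v. if K v = K (Inl 0) then 0 else \<phi> (K v))"
  define F where "F = (\<lambda>\<phi>. mat m n (\<lambda>(i, j). C0 $$ (i, j) + (\<psi> \<phi> (Inl i) - \<psi> \<phi> (Inr j))))"
  have C0_carrier: "C0 \<in> carrier_mat m n"
    using C0 A by (auto simp: completion_def)
  have verts: "verts H = Inl ` {..<m} \<union> Inr ` {..<n}"
    using A by (simp add: H_def verts_entry_graph)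
  have supp_lt: "i < m \<and> j < n" if "(i, j) \<in> support A" for i j
    using that A by (auto simp: support_def)
  have arc: "x \<rightarrow>\<^bsub>H\<^esub> y \<longleftrightarrow> (x, y) \<in> arcs_of (support A)" for x y
    by (simp add: H_def arcs_ends_entry_graph)
  have K_eq: "K x = K y" if "x \<rightarrow>\<^sup>*\<^bsub>H\<^esub> y" for x y
    using that symmetric_reachable' unfolding K_def scc_of_def by (blast intro: reachable_trans)
  have inj: "inj_on F P"
  proof (rule inj_onI)
    fix \<phi> \<phi>'
    assume \<phi>: "\<phi> \<in> P" "\<phi>' \<in> P" and eq: "F \<phi> = F \<phi>'"
    have E: "\<psi> \<phi> (Inl i) - \<psi> \<phi> (Inr j) = \<psi> \<phi>' (Inl i) - \<psi> \<phi>' (Inr j)" if "i < m" "j < n" for i j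
      using arg_cong[OF eq, of "\<lambda>M. M $$ (i, j)"] that by (simp add: F_def)
    \<comment> \<open>The value at \<open>Inl 0\<close> is 0, so row 0 determines the potential on
      the columns; column 0 then determines it on the rows.\<close>
    have col: "\<psi> \<phi> (Inr j) = \<psi> \<phi>' (Inr j)" if "j < n" for j
      using E[of 0 j] that \<open>m \<ge> 1\<close> by (simp add: \<psi>_def split: if_splits)
    have row: "\<psi> \<phi> (Inl i) = \<psi> \<phi>' (Inl i)" if "i < m" for i
      using E[of i 0] col[of 0] that \<open>n \<ge> 1\<close> by simp
    have \<psi>: "\<psi> \<phi> v = \<psi> \<phi>' v" if "v \<in> verts H" for v
      using that verts row col by auto
    show "\<phi> = \<phi>'"
    proof (rule PiE_ext)
      show "\<phi> \<in> (sccs_verts - {K (Inl 0)}) \<rightarrow>\<^sub>E UNIV" "\<phi>' \<in> (sccs_verts - {K (Inl 0)}) \<rightarrow>\<^sub>E UNIV"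
        using \<phi> by (auto simp: P_def)
      fix S
      assume S: "S \<in> sccs_verts - {K (Inl 0)}"
      then obtain v where "v \<in> verts H" "S = K v"
        by (auto simp: sccs_verts_conv_scc_of K_def)
      with S \<psi>[of v] show "\<phi> S = \<phi>' S"
        by (simp add: \<psi>_def)
    qed
  qed
  have into: "completion A (F \<phi>) \<and> collapsing_sum (F \<phi>) = collapsing_sum C0" for \<phi>
  proof
    have "\<psi> \<phi> (Inl i) = \<psi> \<phi> (Inr j)" if "(i, j) \<in> support A" for i j
    proof -
      have "Inl i \<rightarrow>\<^sup>*\<^bsub>H\<^esub> Inr j"
        using arc that by (intro reachable_adjI) simp
      then show ?thesis
        using K_eq by (simp add: \<psi>_def)
    qed
    then show "completion A (F \<phi>)"
      using C0 A supp_lt by (fastforce simp: completion_iff F_def)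
    show "collapsing_sum (F \<phi>) = collapsing_sum C0"
      by (subst collapsing_sum_eq_iff[of _ m n]) (use C0_carrier in \<open>auto simp: F_def\<close>)
  qed
  have onto: "C \<in> F ` P" if C: "completion A C" "collapsing_sum C = collapsing_sum C0" for C
  proof -
    have C_carrier: "C \<in> carrier_mat m n"
      using C A by (auto simp: completion_def)
    obtain f :: "nat + nat \<Rightarrow> 'a"
      where f: "\<And>i j. i < m \<Longrightarrow> j < n \<Longrightarrow> C $$ (i, j) - C0 $$ (i, j) = f (Inl i) - f (Inr j)"
      using collapsing_sum_eq_iff[OF C_carrier C0_carrier] C(2) by blast
    \<comment> \<open>Both \<open>C\<close> and \<open>C0\<close> extend \<open>A\<close>, so
      \<open>f\<close> agrees at the ends of each edge and is constant on components.\<close>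
    have "f (Inl i) = f (Inr j)" if "(i, j) \<in> support A" for i j
      using f[of i j] C(1) C0 supp_lt[OF that] that by (fastforce simp: completion_iff)
    then have f_arc: "f x = f y" if "x \<rightarrow>\<^bsub>H\<^esub> y" for x y
      using that by (auto simp: arc arcs_of_def)
    have f_reach: "f x = f y" if "x \<rightarrow>\<^sup>*\<^bsub>H\<^esub> y" for x y
      using that by (induction rule: converse_reachable_induct) (auto dest: f_arc)
    have f_K: "f x = f y" if "y \<in> K x" for x y
      using that f_reach by (simp add: K_def scc_of_def)
    \<comment> \<open>Any representative of a component gives the same value; subtracting
      \<open>f (Inl 0)\<close> imposes the normalisation.\<close>
    define \<phi> where "\<phi> = restrict (\<lambda>S. f (SOME v. v \<in> S) - f (Inl 0)) (sccs_verts - {K (Inl 0)})"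
    have \<phi>: "\<psi> \<phi> v = f v - f (Inl 0)" if v: "v \<in> verts H" for v
    proof -
      have vK: "v \<in> K v"
        using in_scc_of_self[OF v] by (simp add: K_def)
      show ?thesis
      proof (cases "K v = K (Inl 0)")
        case True
        then have "v \<in> K (Inl 0)"
          using vK by simp
        then show ?thesis
          using f_K[of v "Inl 0"] True by (simp add: \<psi>_def)
      next
        case False
        have "K v \<in> sccs_verts"
          using scc_of_in_sccs_verts[OF v] by (simp add: K_def)
        then show ?thesis
          using False f_K[OF someI[of "\<lambda>x. x \<in> K v", OF vK]] by (simp add: \<psi>_def \<phi>_def)
      qed
    qed
    have "C $$ (i, j) = F \<phi> $$ (i, j)" if "i < m" "j < n" for i j
    proof -
      have "\<psi> \<phi> (Inl i) - \<psi> \<phi> (Inr j) = C $$ (i, j) - C0 $$ (i, j)"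
        using that verts by (simp add: \<phi> f)
      then show ?thesis
        using that by (simp add: F_def)
    qed
    then have "C = F \<phi>"
      using C_carrier by (intro eq_matI) (auto simp: F_def)
    moreover have "\<phi> \<in> P"
      by (simp add: \<phi>_def P_def)
    ultimately show ?thesis
      by blast
  qed
  have "bij_betw F P {C. completion A C \<and> collapsing_sum C = collapsing_sum C0}"
    using inj into onto unfolding bij_betw_def by blast
  then show ?thesis
    unfolding P_def by blast
qed

text \<open>Infinite sets have \<open>card\<close> 0, so uniqueness can be read off from a
  cardinality over infinite groups as well.\<close>

lemma ex1_iff_card_1: "(\<exists>!x. P x) \<longleftrightarrow> card {x. P x} = 1"
  by (auto simp: card_1_singleton_iff Ex1_def set_eq_iff)

lemma card_PiE_UNIV_eq_1:
  assumes "finite I"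
  shows "card (I \<rightarrow>\<^sub>E (UNIV :: 'a::zero set)) = 1 \<longleftrightarrow> I = {} \<or> (\<forall>g::'a. g = 0)"
proof -
  have "card (UNIV :: 'a set) = 1 \<longleftrightarrow> (\<forall>g::'a. g = 0)"
    by (metis UNIV_I UNIV_eq_I card_1_singleton_iff insertI1 One_nat_def singletonD)
  then show ?thesis
    using assms by (auto simp: card_PiE)
qed

text \<open>Over the trivial group a completion is unique whatever the graph, so a nonzero element
  is asked for where uniqueness is to imply connectedness.\<close>

theorem theorem1p3:
  fixes A :: "'a::ab_group_add option mat" and B B' :: "'a mat" and m n :: nat
  assumes "m \<ge> 1" and "n \<ge> 1"
    and "A \<in> carrier_mat m n"
    and "B \<in> carrier_mat (m - 1) (n - 1)"
    and "B' \<in> carrier_mat m n"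
    and "collapsing_sum B' = B"
  shows "(consistent A B \<longleftrightarrow> cycle_balanced (partial_diff A (partial_of B'))) \<and>
    (consistent A B \<longrightarrow>
      (connected (entry_graph A) \<longrightarrow> (\<exists>!C. completion A C \<and> collapsing_sum C = B)) \<and>
      ((\<exists>g::'a. g \<noteq> 0) \<longrightarrow>
        ((\<exists>!C. completion A C \<and> collapsing_sum C = B) \<longleftrightarrow> connected (entry_graph A)))) \<and>
    (\<forall>k. finite (UNIV :: 'a set) \<and> card (UNIV :: 'a set) = k \<and> consistent A B \<longrightarrow>
      card {C. completion A C \<and> collapsing_sum C = B}
        = k ^ (num_components (entry_graph A) - 1))"
proof -
  define H where "H = entry_graph A"
  interpret graph H
    unfolding H_def by (rule graph_entry_graph)
  have v0: "Inl 0 \<in> verts H"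
    using assms(1,3) by (auto simp: H_def verts_entry_graph)
  let ?I = "sccs_verts - {scc_of (Inl 0)}"
  have card: "card {C. completion A C \<and> collapsing_sum C = B} = card (?I \<rightarrow>\<^sub>E (UNIV :: 'a set))"
    if "consistent A B"
  proof -
    obtain C0 where "completion A C0" "collapsing_sum C0 = B"
      using \<open>consistent A B\<close> by (auto simp: consistent_def)
    then obtain F where F: "bij_betw F (?I \<rightarrow>\<^sub>E (UNIV :: 'a set))
      {C. completion A C \<and> collapsing_sum C = B}"
      using bij_betw_completions[OF assms(3,1,2)] unfolding H_def by blast
    show ?thesis
      using bij_betw_same_card[OF F] by (rule sym)
  qed
  have fin: "finite ?I"
    using finite_sccs_verts by simp
  have in_sccs: "scc_of (Inl 0) \<in> sccs_verts"
    using v0 by (rule scc_of_in_sccs_verts)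
  have unique: "(\<exists>!C. completion A C \<and> collapsing_sum C = B) \<longleftrightarrow>
      connected (entry_graph A) \<or> (\<forall>g::'a. g = 0)" if "consistent A B"
  proof -
    have "connected H \<longleftrightarrow> ?I = {}"
      using connected_iff_sccs_verts[OF _ v0] graph_axioms in_sccs by blast
    then show ?thesis
      unfolding ex1_iff_card_1 card[OF that] card_PiE_UNIV_eq_1[OF fin] H_def[symmetric] by simp
  qed
  \<comment> \<open>Leaving out the component of \<open>Inl 0\<close> accounts for the 1 subtracted
    in the exponent.\<close>
  have "card (?I \<rightarrow>\<^sub>E (UNIV :: 'a set)) = card (UNIV :: 'a set) ^ (num_components H - 1)"
    using fin in_sccs by (simp add: card_PiE num_components_def card_sccs_verts)
  then show ?thesis
    using consistent_iff_cycle_balanced[OF assms(3,5)] unique card assms(6)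
    unfolding H_def by auto
qed

end
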